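(* Let $d$ and $n$ be positive integers with $d\mid n$, let $\zeta\in\mathbb{C}$ be a primitive $d$-th root of unity, and let $T$ be a chain on $[n]=\{1,\dots,n\}$, regarded as an endofunction of $[n]$. Then $$\sigma(d;T)=g_T(\zeta,\zeta^2,\dots,\zeta^d).$$
   Context: A chain on $[n]$ is $a_1\to a_2\to\cdots\to a_n$ with $a_1,\dots,a_n$ the distinct elements of $[n]$ in some order; it is regarded as the endofunction $T$ with $T(a_i)=a_{i+1}$ for $i<n$ and $T(a_n)=a_n$. For an endofunction $T$ on a set of size $n$ with $d\mid n$, a subset $W$ of cardinality $n/d$ is $d$-splitting if $W\cup TW\cup\cdots\cup T^{d-1}W$ is the whole set ($T^i$ is the $i$-fold composition); $\sigma(d;T)$ is the number of $d$-splitting subsets. A subset $U$ is $T$-invariant if $TU\subseteq U$. A $d$-flag of $T$-invariant subsets of $[n]$ is a sequence $\emptyset=U_0\subseteq U_1\subseteq\cdots\subseteq U_{d-1}\subseteq U_d=[n]$ with every $U_i$ $T$-invariant. The generating function of $d$-flags is $g_T(t_1,\dots,t_d)=\sum_J a_J\,t_1^{j_1}\cdots t_d^{j_d}$, the sum over $d$-tuples $J=(j_1,\dots,j_d)$ of non-negative integers, where $a_J$ is the number of $d$-flags with $|U_i|=j_1+\cdots+j_i$ for all $1\le i\le d$. *)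

theory Defs
  imports Complex_Main "HOL-Library.FuncSet"
begin

definition primitive_root_of_unity :: "nat \<Rightarrow> complex \<Rightarrow> bool" where
  "primitive_root_of_unity d z \<longleftrightarrow> d > 0 \<and> z ^ d = 1 \<and> (\<forall>k. 0 < k \<and> k < d \<longrightarrow> z ^ k \<noteq> 1)"

text \<open>An endofunction of \<open>S\<close> is rendered as a total function on the ambient type; everything below
  depends only on its restriction to \<open>S\<close>.\<close>

definition chain_on :: "nat \<Rightarrow> (nat \<Rightarrow> nat) \<Rightarrow> bool" where
  "chain_on n T \<longleftrightarrow>
     (\<exists>a. bij_betw a {1..n} {1..n} \<and> (\<forall>i\<in>{1..<n}. T (a i) = a (Suc i)) \<and> T (a n) = a n)"

definition splitting_subset :: "nat \<Rightarrow> 'a set \<Rightarrow> ('a \<Rightarrow> 'a) \<Rightarrow> 'a set \<Rightarrow> bool" where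
  "splitting_subset d S T W \<longleftrightarrow>
     W \<subseteq> S \<and> card W = card S div d \<and> (\<Union>i<d. (T ^^ i) ` W) = S"

definition sigma :: "nat \<Rightarrow> 'a set \<Rightarrow> ('a \<Rightarrow> 'a) \<Rightarrow> nat" where
  "sigma d S T = card {W. splitting_subset d S T W}"

definition invariant_subset :: "'a set \<Rightarrow> ('a \<Rightarrow> 'a) \<Rightarrow> 'a set \<Rightarrow> bool" where
  "invariant_subset S T U \<longleftrightarrow> U \<subseteq> S \<and> T ` U \<subseteq> U"

text \<open>Sequences \<open>U\<^sub>0, \<dots>, U\<^sub>d\<close> and tuples \<open>(j\<^sub>1, \<dots>, j\<^sub>d)\<close> are extensional functions on
  \<open>{0..d}\<close> and \<open>{1..d}\<close>, so that each is represented by exactly one function.\<close>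

definition flags :: "nat \<Rightarrow> 'a set \<Rightarrow> ('a \<Rightarrow> 'a) \<Rightarrow> (nat \<Rightarrow> 'a set) set" where
  "flags d S T =
     {U \<in> {0..d} \<rightarrow>\<^sub>E {V. invariant_subset S T V}.
        U 0 = {} \<and> U d = S \<and> (\<forall>i<d. U i \<subseteq> U (Suc i))}"

definition flag_count :: "nat \<Rightarrow> 'a set \<Rightarrow> ('a \<Rightarrow> 'a) \<Rightarrow> (nat \<Rightarrow> nat) \<Rightarrow> nat" where
  "flag_count d S T J =
     card {U \<in> flags d S T. \<forall>i\<in>{1..d}. card (U i) = (\<Sum>k=1..i. J k)}"

definition flag_types :: "nat \<Rightarrow> 'a set \<Rightarrow> ('a \<Rightarrow> 'a) \<Rightarrow> (nat \<Rightarrow> nat) set" where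
  "flag_types d S T = {J \<in> {1..d} \<rightarrow>\<^sub>E UNIV. flag_count d S T J \<noteq> 0}"

text \<open>The sum over all tuples \<open>J\<close> has only finitely many nonzero terms; \<open>sum\<close> needs a finite index
  set, hence the restriction to the tuples with nonzero coefficient, a finite set by the next lemma.\<close>

definition flag_gf ::
  "nat \<Rightarrow> 'a set \<Rightarrow> ('a \<Rightarrow> 'a) \<Rightarrow> (nat \<Rightarrow> 'b::comm_semiring_1) \<Rightarrow> 'b" where
  "flag_gf d S T t =
     (\<Sum>J\<in>flag_types d S T. of_nat (flag_count d S T J) * (\<Prod>i=1..d. t i ^ J i))"

lemma finite_flag_types:
  assumes "finite S"
  shows "finite (flag_types d S T)"
proof (rule finite_subset)
  show "flag_types d S T \<subseteq> {1..d} \<rightarrow>\<^sub>E {..card S}"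
  proof
    fix J assume J: "J \<in> flag_types d S T"
    then have "{U \<in> flags d S T. \<forall>i\<in>{1..d}. card (U i) = (\<Sum>k=1..i. J k)} \<noteq> {}"
      unfolding flag_types_def flag_count_def by (metis (mono_tags, lifting) card.empty mem_Collect_eq)
    then obtain U where U: "U \<in> flags d S T" "\<forall>i\<in>{1..d}. card (U i) = (\<Sum>k=1..i. J k)"
      by blast
    have "J i \<le> card S" if i: "i \<in> {1..d}" for i
    proof -
      have "J i \<le> (\<Sum>k=1..i. J k)"
        using i by (intro member_le_sum) auto
      also have "\<dots> = card (U i)"
        using U(2) i by simp
      also have "\<dots> \<le> card S"
      proof (rule card_mono[OF assms])
        have "U i \<in> {V. invariant_subset S T V}"
          using U(1) i unfolding flags_def by (auto simp: PiE_iff)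
        then show "U i \<subseteq> S"
          by (simp add: invariant_subset_def)
      qed
      finally show ?thesis .
    qed
    then show "J \<in> {1..d} \<rightarrow>\<^sub>E {..card S}"
      using J unfolding flag_types_def by (auto simp: PiE_iff)
  qed
  show "finite ({1..d} \<rightarrow>\<^sub>E {..card S})"
    by (intro finite_PiE) auto
qed

end

theory Submission
  imports Defs "HOL-Computational_Algebra.Polynomial_FPS"
begin

text \<open>
  The invariant subsets of a chain are its terminal segments, one of each size, so \<open>a\<^sub>J = 1\<close> for every
  weak composition \<open>J\<close> of \<open>n\<close> into \<open>d\<close> parts and \<open>g\<^sub>T\<close> is the complete homogeneous symmetric polynomial
  \<open>h\<^sub>n\<close>. Its value at \<open>\<zeta>, \<dots>, \<zeta>\<^sup>d\<close> is the coefficient of \<open>X\<^sup>n\<close> in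
  \<open>\<Prod>\<^sub>i 1 / (1 - \<zeta>\<^sup>i X) = 1 / (1 - X\<^sup>d)\<close>, which is \<open>1\<close> because \<open>d\<close> divides \<open>n\<close>.
  On the other side, a splitting subset of a chain must tile it by consecutive blocks of length \<open>d\<close>,
  so there is exactly one.
\<close>

section \<open>Complete homogeneous symmetric polynomials at roots of unity\<close>

text \<open>Links generating functions to weak compositions: expanding the product picks one
  exponent from each factor. Induction on \<open>A\<close> peels off one factor by the Cauchy
  product.\<close>

lemma fps_nth_prod_compositions:
  fixes f :: "'i \<Rightarrow> 'a::comm_semiring_1 fps"
  assumes "finite A"
  shows "fps_nth (\<Prod>i\<in>A. f i) n =
    (\<Sum>J\<in>{J \<in> A \<rightarrow>\<^sub>E UNIV. sum J A = n}. \<Prod>i\<in>A. fps_nth (f i) (J i))"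
  using assms
proof (induction A arbitrary: n rule: finite_induct)
  case empty
  have "{J \<in> {} \<rightarrow>\<^sub>E UNIV. sum J {} = n} = (if n = 0 then {\<lambda>_. undefined} else {})"
    for n :: nat by (auto simp: PiE_def extensional_def)
  then show ?case by simp
next
  case (insert k A)
  let ?C = "\<lambda>A n. {J \<in> A \<rightarrow>\<^sub>E (UNIV :: nat set). sum J A = n}"
  have fin: "finite (?C A m)" for m
  proof (rule finite_subset)
    show "?C A m \<subseteq> A \<rightarrow>\<^sub>E {..m}"
    proof
      fix J assume J: "J \<in> ?C A m"
      then have "J i \<le> m" if "i \<in> A" for i
        using member_le_sum[of i A J] that insert.hyps(1) by auto
      then show "J \<in> A \<rightarrow>\<^sub>E {..m}" using J by (simp add: PiE_iff)
    qed
    show "finite (A \<rightarrow>\<^sub>E {..m})" using insert.hyps by (intro finite_PiE) auto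
  qed
  have upd_sum: "(\<Sum>i\<in>A. if i = k then v else J i) = sum J A" for J :: "'i \<Rightarrow> nat" and v
    using insert.hyps by (intro sum.cong) auto
  have upd_prod: "(\<Prod>i\<in>A. fps_nth (f i) (if i = k then v else J i)) = (\<Prod>i\<in>A. fps_nth (f i) (J i))"
    for J and v :: nat
    using insert.hyps by (intro prod.cong) auto
  have "fps_nth (\<Prod>i\<in>insert k A. f i) n =
      (\<Sum>j=0..n. fps_nth (f k) j * (\<Sum>J\<in>?C A (n - j). \<Prod>i\<in>A. fps_nth (f i) (J i)))"
    using insert by (simp add: fps_mult_nth)
  also have "\<dots> = (\<Sum>(j, J)\<in>(SIGMA j:{0..n}. ?C A (n - j)).
      fps_nth (f k) j * (\<Prod>i\<in>A. fps_nth (f i) (J i)))"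
    using fin by (simp add: sum_distrib_left sum.Sigma)
  also have "\<dots> = (\<Sum>J\<in>?C (insert k A) n. \<Prod>i\<in>insert k A. fps_nth (f i) (J i))"
  \<comment> \<open>A pair (exponent at \<open>k\<close>, composition over \<open>A\<close>) is the
    same as a composition over \<open>insert k A\<close>. Resetting the value at \<open>k\<close> to
    \<open>undefined\<close> keeps the smaller tuple extensional, so the two maps are mutually
    inverse.\<close>
  proof (rule sum.reindex_bij_witness[where i = "\<lambda>J. (J k, J(k := undefined))"
        and j = "\<lambda>(j, J). J(k := j)"], goal_cases)
    case (1 p)
    then show ?case using insert.hyps by (auto simp: PiE_def extensional_def fun_eq_iff)
  next
    case (2 p)
    then show ?case
      using insert.hyps by (auto simp: upd_sum PiE_def extensional_def)
  next
    case (3 J)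
    then show ?case by auto
  next
    case (4 J)
    then show ?case using insert.hyps by (auto simp: upd_sum PiE_def extensional_def)
  next
    case (5 p)
    then show ?case using insert.hyps by (auto simp: upd_prod)
  qed
  finally show ?case .
qed

lemma fps_geometric_inverse:
  fixes c :: "'a::comm_ring_1"
  shows "(1 - fps_const c * fps_X) * Abs_fps (\<lambda>n. c ^ n) = 1"
proof (rule fps_ext)
  fix n
  show "fps_nth ((1 - fps_const c * fps_X) * Abs_fps (\<lambda>n. c ^ n)) n = fps_nth 1 n"
    by (cases n) (simp_all add: algebra_simps)
qed

text \<open>The two contributions to a coefficient of index \<open>n \<ge> d\<close> cancel, since
  \<open>d\<close> divides \<open>n\<close> iff it divides \<open>n - d\<close>; below
  \<open>d\<close> only index 0 is a multiple.\<close>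

lemma fps_indicator_multiples:
  assumes "d > 0"
  shows "(1 - fps_X ^ d) * Abs_fps (\<lambda>n. if d dvd n then 1 else 0 :: 'a::comm_ring_1) = 1"
proof (rule fps_ext)
  fix n
  show "fps_nth ((1 - fps_X ^ d) * Abs_fps (\<lambda>n. if d dvd n then 1 else 0 :: 'a)) n = fps_nth 1 n"
    using assms
    by (auto simp: algebra_simps fps_X_power_mult_nth dvd_minus_self dest: dvd_imp_le)
qed

lemma primitive_root_powers_inj:
  assumes "primitive_root_of_unity d z"
  shows "inj_on (\<lambda>i. z ^ i) {1..d}"
proof (rule linorder_inj_onI)
  fix i j assume ij: "i < j" "i \<in> {1..d}" "j \<in> {1..d}"
  have "z \<noteq> 0" using assms by (auto simp: primitive_root_of_unity_def power_0_left)
  have "z ^ (j - i) \<noteq> 1"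
    using assms ij by (auto simp: primitive_root_of_unity_def)
  then show "z ^ i \<noteq> z ^ j"
    using ij \<open>z \<noteq> 0\<close> by (auto simp: power_diff)
qed auto

text \<open>Two polynomials of degree at most \<open>d\<close> that agree at \<open>d + 1\<close>
  points are equal. The points are the \<open>d\<close> inverse powers of \<open>z\<close>, distinct
  by primitivity, where both sides vanish, and 0, where both sides are 1.\<close>

lemma prod_one_minus_root_powers:
  assumes "primitive_root_of_unity d z"
  shows "(\<Prod>i=1..d. [:1, - (z ^ i):]) = 1 - monom 1 d"
proof -
  let ?A = "insert 0 ((\<lambda>i. inverse (z ^ i)) ` {1..d})"
  have d: "d > 0" and zd: "z ^ d = 1" and z0: "z \<noteq> 0"
    using assms by (auto simp: primitive_root_of_unity_def power_0_left)
  have "inj_on (\<lambda>i. inverse (z ^ i)) {1..d}"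
    using primitive_root_powers_inj[OF assms] unfolding inj_on_def inverse_eq_iff_eq .
  then have card: "card ?A = Suc d"
    using z0 by (subst card_insert_disjoint) (auto simp: card_image)
  show ?thesis
  proof (rule poly_eqI_degree[of ?A])
    fix x assume x: "x \<in> ?A"
    show "poly (\<Prod>i=1..d. [:1, - (z ^ i):]) x = poly (1 - monom 1 d) x"
    proof (cases "x = 0")
      case True
      then show ?thesis using d by (simp add: poly_prod poly_monom)
    next
      case False
      then obtain i where i: "i \<in> {1..d}" "x = inverse (z ^ i)" using x by auto
      have "x ^ d = inverse ((z ^ d) ^ i)"
        by (simp add: i(2) power_inverse mult.commute flip: power_mult)
      moreover have "poly (\<Prod>i=1..d. [:1, - (z ^ i):]) x = 0"
        using i z0 by (auto simp: poly_prod intro!: bexI[of _ i])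
      ultimately show ?thesis by (simp add: zd poly_monom)
    qed
  next
    have "degree (\<Prod>i=1..d. [:1, - (z ^ i):]) \<le> (\<Sum>i=1..d. degree [:1, - (z ^ i):])"
      by (rule degree_prod_sum_le[unfolded o_def]) simp
    also have "\<dots> \<le> d" using sum_bounded_above[of "{1..d}" "\<lambda>i. degree [:1, - (z ^ i):]" 1] by simp
    finally show "degree (\<Prod>i=1..d. [:1, - (z ^ i):]) < card ?A" by (simp only: card)
    have "degree (1 - monom 1 d :: complex poly) \<le> d"
      by (rule degree_diff_le) (simp_all add: degree_monom_le)
    then show "degree (1 - monom 1 d :: complex poly) < card ?A" by (simp only: card)
  qed
qed

lemma complete_homogeneous_root_powers:
  assumes "primitive_root_of_unity d z"
  shows "(\<Sum>J\<in>{J \<in> {1..d} \<rightarrow>\<^sub>E UNIV. sum J {1..d} = n}. \<Prod>i=1..d. (z ^ i) ^ J i) =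
    (if d dvd n then 1 else 0)"
proof -
  let ?G = "\<Prod>i=1..d. Abs_fps (\<lambda>n. (z ^ i) ^ n)"
  let ?E = "Abs_fps (\<lambda>n. if d dvd n then 1 else 0 :: complex)"
  have d: "d > 0" using assms by (simp add: primitive_root_of_unity_def)
  have "(\<Prod>i=1..d. 1 - fps_const (z ^ i) * fps_X) = fps_of_poly (\<Prod>i=1..d. [:1, - (z ^ i):])"
    by (simp add: fps_of_poly_prod fps_of_poly_pCons flip: fps_const_neg)
  also have "\<dots> = 1 - fps_X ^ d"
    unfolding prod_one_minus_root_powers[OF assms]
    by (simp add: fps_of_poly_diff fps_of_poly_monom)
  finally have "(1 - fps_X ^ d) * ?G = (\<Prod>i=1..d. (1 - fps_const (z ^ i) * fps_X) * Abs_fps (\<lambda>n. (z ^ i) ^ n))"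
    by (simp only: prod.distrib)
  also have "\<dots> = 1" by (simp only: fps_geometric_inverse prod.neutral_const)
  finally have G: "(1 - fps_X ^ d) * ?G = 1" .
  \<comment> \<open>\<open>?G\<close> and \<open>?E\<close> are both inverse to
    \<open>1 - fps_X ^ d\<close>, and inverses are unique.\<close>
  have "?G = ?G * ((1 - fps_X ^ d) * ?E)" by (simp only: fps_indicator_multiples[OF d] mult_1_right)
  also have "\<dots> = ((1 - fps_X ^ d) * ?G) * ?E" by (simp only: ac_simps)
  also have "\<dots> = ?E" by (simp only: G mult_1)
  finally have "?G = ?E" .
  then have "fps_nth ?G n = fps_nth ?E n" by (rule arg_cong)
  then show ?thesis by (simp add: fps_nth_prod_compositions)
qed

section \<open>Flags of invariant subsets of a chain\<close>

text \<open>Closure under successor fills everything from the minimum up to \<open>n\<close>, and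
  the cardinality then determines that minimum.\<close>

lemma upward_closed_eq_terminal_segment:
  fixes I :: "nat set"
  assumes "I \<subseteq> {1..n}" and "\<And>i. i \<in> I \<Longrightarrow> i < n \<Longrightarrow> Suc i \<in> I"
  shows "I = {n - card I<..n}"
proof (cases "I = {}")
  case False
  have fin: "finite I" using assms(1) finite_subset by blast
  define m where "m = Min I"
  have m: "m \<in> I" using False fin by (simp add: m_def)
  have "{m..n} \<subseteq> I"
  proof
    fix j assume "j \<in> {m..n}"
    then have "m \<le> j" "j \<le> n" by auto
    then show "j \<in> I" by (induction j rule: dec_induct) (use m assms(2) in auto)
  qed
  moreover have "I \<subseteq> {m..n}" using assms(1) fin by (auto simp: m_def)
  ultimately have "I = {m..n}" by blast
  then show ?thesis using m assms(1) by auto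
qed auto

text \<open>Fixing the enumeration \<open>a\<close> moves every question to positions in
  \<open>{1..n}\<close>, where \<open>T\<close> is the successor map stopped at
  \<open>n\<close>.\<close>

locale chain =
  fixes n :: nat and T a :: "nat \<Rightarrow> nat"
  assumes bij: "bij_betw a {1..n} {1..n}"
    and step: "i \<in> {1..<n} \<Longrightarrow> T (a i) = a (Suc i)"
    and fixpoint: "T (a n) = a n"
begin

text \<open>Truncated subtraction makes this the whole chain for \<open>k > n\<close>, so
  monotonicity and invariance hold for all \<open>k\<close>.\<close>

definition segment :: "nat \<Rightarrow> nat set" where
  "segment k = a ` {n - k<..n}"

lemma inj: "inj_on a {1..n}"
  using bij by (simp add: bij_betw_def)

lemma image_a: "a ` {1..n} = {1..n}"
  using bij by (simp add: bij_betw_def)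

lemma card_segment: "k \<le> n \<Longrightarrow> card (segment k) = k"
  unfolding segment_def by (subst card_image) (auto intro: inj_on_subset[OF inj])

lemma segment_mono: "k \<le> l \<Longrightarrow> segment k \<subseteq> segment l"
  unfolding segment_def by (intro image_mono) auto

lemma segment_invariant: "invariant_subset {1..n} T (segment k)"
proof -
  have "segment k \<subseteq> a ` {1..n}"
    unfolding segment_def by (intro image_mono) auto
  then have "segment k \<subseteq> {1..n}" by (simp only: image_a)
  moreover have "T ` segment k \<subseteq> segment k"
  proof -
    have "T (a i) \<in> segment k" if "i \<in> {n - k<..n}" for i
    proof (cases "i = n")
      case True
      then show ?thesis using that fixpoint by (auto simp: segment_def)
    next
      case False
      then show ?thesis using that step[of i] by (auto simp: segment_def)
    qed
    then show ?thesis by (auto simp: segment_def)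
  qed
  ultimately show ?thesis by (simp add: invariant_subset_def)
qed

text \<open>Invariance under \<open>T\<close> is closure of the set of positions under
  successor.\<close>

lemma invariant_eq_segment:
  assumes "invariant_subset {1..n} T V"
  shows "V = segment (card V)"
proof -
  define I where "I = {i \<in> {1..n}. a i \<in> V}"
  have "V \<subseteq> a ` {1..n}" using assms by (simp only: invariant_subset_def image_a)
  then have V: "V = a ` I" unfolding I_def by blast
  have "inj_on a I" by (rule inj_on_subset[OF inj]) (auto simp: I_def)
  then have "card V = card I" by (simp add: V card_image)
  moreover have "I = {n - card I<..n}"
  proof (rule upward_closed_eq_terminal_segment)
    fix i assume "i \<in> I" "i < n"
    then have i: "a i \<in> V" "i \<in> {1..<n}" by (auto simp: I_def)
    then have "T (a i) \<in> V" using assms by (auto simp: invariant_subset_def)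
    then show "Suc i \<in> I" using i step by (auto simp: I_def)
  qed (auto simp: I_def)
  ultimately show ?thesis using V by (simp add: segment_def)
qed

text \<open>Each member of a flag is determined by its size, so the type determines the flag. The
  only constraint left is that the sizes end at \<open>n\<close>.\<close>

lemma flag_count_eq:
  assumes "d > 0"
  shows "flag_count d {1..n} T J = (if sum J {1..d} = n then 1 else 0)"
proof -
  let ?F = "{U \<in> flags d {1..n} T. \<forall>i\<in>{1..d}. card (U i) = (\<Sum>k=1..i. J k)}"
  show ?thesis
  proof (cases "sum J {1..d} = n")
    case False
    have "?F = {}"
    proof (rule ccontr)
      assume "?F \<noteq> {}"
      then obtain U where "U d = {1..n}" "\<forall>i\<in>{1..d}. card (U i) = (\<Sum>k=1..i. J k)"
        by (auto simp: flags_def)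
      then have "n = sum J {1..d}"
        using assms by (metis One_nat_def Suc_leI atLeastAtMost_iff card_atLeastAtMost diff_Suc_1 le_refl)
      then show False using False by simp
    qed
    then show ?thesis using False by (simp only: flag_count_def card.empty if_False)
  next
    case True
    define V where "V = restrict (\<lambda>i. segment (\<Sum>k=1..i. J k)) {0..d}"
    have le: "(\<Sum>k=1..i. J k) \<le> n" if "i \<le> d" for i
      unfolding True[symmetric] using that by (intro sum_mono2) auto
    have "?F = {V}"
    proof (intro equalityI subsetI)
      fix U assume U: "U \<in> ?F"
      have "U i = V i" if "i \<le> d" for i
      proof (cases "i = 0")
        \<comment> \<open>The size condition starts at index 1; at index 0 both sets are
          empty.\<close>
        case True
        then show ?thesis using U by (auto simp: flags_def V_def segment_def)
      next
        case False
        have "U i = segment (card (U i))"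
          using U that by (intro invariant_eq_segment) (auto simp: flags_def PiE_iff)
        then show ?thesis using U that False by (simp add: V_def)
      qed
      moreover have "U i = V i" if "\<not> i \<le> d" for i
        using U that by (auto simp: flags_def V_def PiE_iff extensional_def)
      ultimately have "U = V" by blast
      then show "U \<in> {V}" by simp
    next
      fix U assume "U \<in> {V}"
      moreover have "V \<in> flags d {1..n} T"
      proof -
        have "V \<in> {0..d} \<rightarrow>\<^sub>E {V. invariant_subset {1..n} T V}"
          using segment_invariant by (auto simp: V_def)
        moreover have "V 0 = {}" by (simp add: V_def segment_def)
        moreover have "segment n = {1..n}"
          using image_a by (simp add: segment_def atLeastSucAtMost_greaterThanAtMost)
        then have "V d = {1..n}" by (simp only: V_def True restrict_apply) simp
        moreover have "V i \<subseteq> V (Suc i)" if "i < d" for i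
          using that by (simp add: V_def segment_mono)
        ultimately show ?thesis by (simp add: flags_def)
      qed
      ultimately show "U \<in> ?F" using le by (auto simp: V_def card_segment)
    qed
    then show ?thesis using True by (simp add: flag_count_def del: mem_Collect_eq)
  qed
qed

text \<open>All coefficients are 0 or 1, so the index set \<open>flag_types\<close> consists of
  exactly the weak compositions of \<open>n\<close>.\<close>

lemma flag_gf_root_powers:
  assumes "primitive_root_of_unity d z" and "d dvd n"
  shows "flag_gf d {1..n} T (\<lambda>i. z ^ i) = 1"
proof -
  have d: "d > 0" using assms by (simp add: primitive_root_of_unity_def)
  have "flag_types d {1..n} T = {J \<in> {1..d} \<rightarrow>\<^sub>E UNIV. sum J {1..d} = n}"
    unfolding flag_types_def flag_count_eq[OF d] by (intro Collect_cong) auto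
  then have "flag_gf d {1..n} T (\<lambda>i. z ^ i) =
      (\<Sum>J\<in>{J \<in> {1..d} \<rightarrow>\<^sub>E UNIV. sum J {1..d} = n}. \<Prod>i=1..d. (z ^ i) ^ J i)"
    unfolding flag_gf_def flag_count_eq[OF d] by (intro sum.cong) auto
  then show ?thesis
    using complete_homogeneous_root_powers[OF assms(1)] assms(2) by simp
qed

end

section \<open>Splitting subsets of a chain\<close>

text \<open>Once each block has a single start, induction pushes every start to the left end of its
  block: the interval from the previous left end stops just short of the next block.\<close>

lemma interval_tiling_unique:
  fixes I :: "nat set"
  assumes d: "d > 0" and card: "card I = m" and sub: "I \<subseteq> {1..m * d}"
    and cover: "\<And>x. x \<in> {1..m * d} \<Longrightarrow> \<exists>i\<in>I. i \<le> x \<and> x < i + d"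
  shows "I = (\<lambda>k. k * d + 1) ` {..<m}"
proof -
  have fin: "finite I" using sub finite_subset by blast
  let ?b = "\<lambda>i. (i - 1) div d"
  text \<open>The last point of each block is covered from within that block, so \<open>I\<close> has exactly one
    element in each of the \<open>m\<close> blocks.\<close>
  have "{..<m} \<subseteq> ?b ` I"
  proof
    fix k assume k: "k \<in> {..<m}"
    then have "Suc k * d \<le> m * d" by (intro mult_le_mono1) auto
    then have "(k + 1) * d \<in> {1..m * d}" using d by auto
    from cover[OF this] obtain i where i: "i \<in> I" "i \<le> (k + 1) * d" "(k + 1) * d < i + d" by blast
    have "?b i = k" using i(2,3) by (intro div_nat_eqI) (auto simp: algebra_simps)
    then show "k \<in> ?b ` I" using i by blast
  qed
  moreover have "?b ` I \<subseteq> {..<m}"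
    using sub d by (force simp: div_less_iff_less_mult)
  ultimately have "?b ` I = {..<m}" by blast
  \<comment> \<open>A map from the \<open>m\<close> elements of \<open>I\<close> onto
    \<open>m\<close> blocks is injective.\<close>
  then have inj: "inj_on ?b I" using card fin by (intro eq_card_imp_inj_on) auto
  have mem: "k * d + 1 \<in> I" if "k < m" for k
    using that
  proof (induction k)
    case 0
    then have "1 \<in> {1..m * d}" using d by auto
    from cover[OF this] obtain i where "i \<in> I" "i \<le> 1" by blast
    moreover have "i \<ge> 1" using sub \<open>i \<in> I\<close> by auto
    ultimately show ?case by simp
  next
    case (Suc k)
    have "Suc (Suc k) * d \<le> m * d" using Suc.prems by (intro mult_le_mono1) auto
    then have "Suc k * d + 1 \<in> {1..m * d}" using d by auto
    from cover[OF this] obtain i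
      where i: "i \<in> I" "i \<le> Suc k * d + 1" "Suc k * d + 1 < i + d" by blast
    show ?case
    proof (rule ccontr)
      assume "Suc k * d + 1 \<notin> I"
      then have "i \<noteq> Suc k * d + 1" using i(1) by auto
      \<comment> \<open>The covering start would lie in the previous block, strictly after its left
        end, which by induction is already the only start there.\<close>
      then have "?b i = k" using i(2,3) by (intro div_nat_eqI) (auto simp: algebra_simps)
      also have "k = ?b (k * d + 1)" using d by simp
      finally have "i = k * d + 1" by (rule inj_onD[OF inj]) (use i(1) Suc in simp_all)
      then show False using i(3) by simp
    qed
  qed
  have "inj_on (\<lambda>k. k * d + 1) {..<m}" using d by (auto simp: inj_on_def)
  then have "card ((\<lambda>k. k * d + 1) ` {..<m}) = card I" by (simp add: card_image card)
  moreover have "(\<lambda>k. k * d + 1) ` {..<m} \<subseteq> I" using mem by auto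
  ultimately show ?thesis using fin card_subset_eq by metis
qed

context chain
begin

text \<open>The \<open>min\<close> records that iterates are absorbed at the last element.\<close>

lemma funpow_a:
  assumes "i \<in> {1..n}"
  shows "(T ^^ k) (a i) = a (min (i + k) n)"
proof (induction k)
  case (Suc k)
  show ?case
  proof (cases "i + k < n")
    case True
    then show ?thesis using Suc step[of "i + k"] assms by simp
  next
    case False
    then show ?thesis using Suc fixpoint by simp
  qed
qed (use assms in simp)

lemma splitting_subset_iff:
  assumes d: "d > 0" and n: "n = m * d"
  shows "splitting_subset d {1..n} T W \<longleftrightarrow> W = a ` (\<lambda>k. k * d + 1) ` {..<m}"
proof
  assume W: "splitting_subset d {1..n} T W"
  define I where "I = {i \<in> {1..n}. a i \<in> W}"
  have "W \<subseteq> a ` {1..n}" using W by (simp only: splitting_subset_def image_a)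
  then have WI: "W = a ` I" unfolding I_def by blast
  have "inj_on a I" by (rule inj_on_subset[OF inj]) (auto simp: I_def)
  then have "card I = m"
    using W d by (simp add: WI card_image splitting_subset_def n)
  moreover have "\<exists>i\<in>I. i \<le> x \<and> x < i + d" if x: "x \<in> {1..n}" for x
  proof -
    have "a x \<in> {1..n}" using x image_a by blast
    then have "a x \<in> (\<Union>k<d. (T ^^ k) ` W)" using W by (simp add: splitting_subset_def)
    then obtain k i where ki: "k < d" "i \<in> I" "a x = (T ^^ k) (a i)" by (auto simp: WI)
    have i: "i \<in> {1..n}" using ki(2) by (simp add: I_def)
    then have "a x = a (min (i + k) n)" using ki(3) funpow_a by simp
    \<comment> \<open>Truncation at \<open>n\<close> only lowers the position and never below
      \<open>i\<close>, so \<open>i \<le> x < i + d\<close> still follows.\<close>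
    then have "x = min (i + k) n" by (rule inj_onD[OF inj]) (use x i in auto)
    then show ?thesis using ki i by (intro bexI[of _ i]) auto
  qed
  ultimately have "I = (\<lambda>k. k * d + 1) ` {..<m}"
    using d n by (intro interval_tiling_unique) (auto simp: I_def)
  then show "W = a ` (\<lambda>k. k * d + 1) ` {..<m}" using WI by simp
next
  let ?I = "(\<lambda>k. k * d + 1) ` {..<m}"
  assume W: "W = a ` ?I"
  have I: "?I \<subseteq> {1..n}"
  proof
    fix i assume "i \<in> ?I"
    then obtain k where k: "k < m" "i = k * d + 1" by auto
    then have "Suc k * d \<le> m * d" by (intro mult_le_mono1) auto
    then show "i \<in> {1..n}" using k d n by auto
  qed
  have sub: "W \<subseteq> {1..n}" using W I image_a by blast
  have "card W = card ?I" unfolding W by (rule card_image[OF inj_on_subset[OF inj I]])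
  also have "\<dots> = m" using d by (subst card_image) (auto simp: inj_on_def)
  finally have "card W = card {1..n} div d" using d n by simp
  moreover have "(\<Union>k<d. (T ^^ k) ` W) = {1..n}"
  proof (intro equalityI subsetI)
    fix y assume "y \<in> (\<Union>k<d. (T ^^ k) ` W)"
    then obtain k i where "i \<in> ?I" "y = (T ^^ k) (a i)" by (auto simp: W)
    then have i: "i \<in> {1..n}" and "y = a (min (i + k) n)" using I funpow_a by auto
    moreover have "min (i + k) n \<in> {1..n}" using i by auto
    ultimately show "y \<in> {1..n}" using image_a by blast
  next
    fix y assume "y \<in> {1..n}"
    then obtain x where x: "x \<in> {1..n}" "y = a x" using image_a by blast
    \<comment> \<open>Positions start at 1, hence the division of \<open>x - 1\<close>:
      \<open>q\<close> is the block of \<open>x\<close> and \<open>r\<close> the number of steps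
      from its left end.\<close>
    define q where "q = (x - 1) div d"
    define r where "r = (x - 1) mod d"
    have xqr: "x = q * d + 1 + r" using x div_mult_mod_eq[of "x - 1" d] by (simp add: q_def r_def)
    have r: "r < d" using d by (simp add: r_def)
    have q: "q < m" using x n d by (auto simp: q_def div_less_iff_less_mult)
    then have "q * d + 1 \<in> {1..n}" using I by blast
    then have "(T ^^ r) (a (q * d + 1)) = y" using x xqr funpow_a by simp
    then show "y \<in> (\<Union>k<d. (T ^^ k) ` W)" using q r unfolding W by blast
  qed
  ultimately show "splitting_subset d {1..n} T W"
    using sub by (simp add: splitting_subset_def)
qed

lemma sigma_eq_1:
  assumes "d > 0" and "d dvd n"
  shows "sigma d {1..n} T = 1"
proof -
  obtain m where "n = m * d" using assms(2) by (metis dvd_def mult.commute)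
  then show ?thesis
    unfolding sigma_def splitting_subset_iff[OF assms(1) \<open>n = m * d\<close>] by simp
qed

end

theorem theorem3p9:
  fixes d n :: nat and \<zeta> :: complex and T :: "nat \<Rightarrow> nat"
  assumes "d > 0" and "n > 0" and "d dvd n"
    and "primitive_root_of_unity d \<zeta>"
    and "chain_on n T"
  shows "of_nat (sigma d {1..n} T) = flag_gf d {1..n} T (\<lambda>i. \<zeta> ^ i)"
proof -
  obtain a where "chain n T a"
    using assms(5) unfolding chain_on_def chain_def by blast
  then interpret chain n T a .
  show ?thesis
    using sigma_eq_1[OF assms(1,3)] flag_gf_root_powers[OF assms(4,3)] by simp
qed

end
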